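(* Let $n\ge2$, $$I_n(a):=\int_{-\infty}^{\infty}\prod_{j=1}^n\frac{1}{1+ita_j}\,dt,\qquad \mathcal{M}:=\Big\{a\in\mathbb{R}^n:\ \sum_{j=1}^na_j=0,\ \sum_{j=1}^na_j^2=1\Big\}.$$ Let $a\in\mathcal{M}$ be a smooth local maximum of $I_n$ on $\mathcal{M}$, and let $\lambda,\mu\in\mathbb{R}$ be the Lagrange multipliers: $$\partial_{a_j}I_n(a)=2\lambda a_j+\mu,\qquad j=1,\dots,n.$$ Assume that $\mu>0$. Then $a$ has exactly one negative coordinate.
   Context: Here $i$ is the imaginary unit. The integral $I_n(a)$ is real and absolutely convergent whenever $a$ has at least two nonzero coordinates, in particular in a neighbourhood of every point of $\mathcal{M}$. "Smooth local maximum of $I_n$ on $\mathcal{M}$" means a point $a\in\mathcal{M}$ at which the restriction $I_n|_{\mathcal{M}}$ has a local maximum and in a neighbourhood (in $\mathbb{R}^n$) of which $I_n$ is twice continuously differentiable. *)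

theory Defs
  imports "HOL-Analysis.Analysis"
begin

(* The integrand at -t is the complex conjugate of the integrand at t, so the integral is
   real and taking Re loses nothing.  The Bochner integral is 0 where the integrand is not
   absolutely integrable, i.e. where a has at most one nonzero coordinate. *)
definition I_fun :: "real ^ 'n::finite \<Rightarrow> real" where
  "I_fun a = Re (LINT t|lborel. (\<Prod>j\<in>UNIV. 1 / (1 + \<i> * complex_of_real t * complex_of_real (a $ j))))"

definition M_set :: "(real ^ 'n::finite) set" where
  "M_set = {a. (\<Sum>j\<in>UNIV. a $ j) = 0 \<and> (\<Sum>j\<in>UNIV. (a $ j)\<^sup>2) = 1}"

definition partial_deriv :: "'n::finite \<Rightarrow> (real ^ 'n \<Rightarrow> real) \<Rightarrow> real ^ 'n \<Rightarrow> real" where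
  "partial_deriv j f a = deriv (\<lambda>s. f (a + s *\<^sub>R axis j 1)) 0"

definition C2_on :: "'a::real_normed_vector set \<Rightarrow> ('a \<Rightarrow> 'b::real_normed_vector) \<Rightarrow> bool" where
  "C2_on U f \<longleftrightarrow>
     (\<exists>(f' :: 'a \<Rightarrow> 'a \<Rightarrow>\<^sub>L 'b) (f'' :: 'a \<Rightarrow> 'a \<Rightarrow>\<^sub>L ('a \<Rightarrow>\<^sub>L 'b)).
        (\<forall>x\<in>U. (f has_derivative blinfun_apply (f' x)) (at x)) \<and>
        (\<forall>x\<in>U. (f' has_derivative blinfun_apply (f'' x)) (at x)) \<and>
        continuous_on U f'')"

definition local_max_on :: "'a::topological_space set \<Rightarrow> ('a \<Rightarrow> real) \<Rightarrow> 'a \<Rightarrow> bool" where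
  "local_max_on S f a \<longleftrightarrow> a \<in> S \<and> (\<forall>\<^sub>F x in at a within S. f x \<le> f a)"

definition smooth_local_max_on :: "'a::real_normed_vector set \<Rightarrow> ('a \<Rightarrow> real) \<Rightarrow> 'a \<Rightarrow> bool" where
  "smooth_local_max_on S f a \<longleftrightarrow>
     local_max_on S f a \<and> (\<exists>U. open U \<and> a \<in> U \<and> C2_on U f)"

end

theory Submission
  imports Defs "HOL-Probability.Sinc_Integral"
begin

text \<open>
  Partial fractions give \<open>\<partial>\<^sub>j\<partial>\<^sub>k ((a\<^sub>j - a\<^sub>k) I) = 0\<close>, that is,
  \<open>\<partial>\<^sub>j I - \<partial>\<^sub>k I = (a\<^sub>j - a\<^sub>k) \<partial>\<^sub>j\<partial>\<^sub>k I\<close>. At a critical point this forces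
  \<open>\<partial>\<^sub>j\<partial>\<^sub>k I = 2\<lambda>\<close> whenever \<open>a\<^sub>j \<noteq> a\<^sub>k\<close>, and \<open>\<partial>\<^sub>j\<^sup>2 I = 2 \<partial>\<^sub>j\<partial>\<^sub>k I\<close> whenever \<open>a\<^sub>j = a\<^sub>k\<close>. As \<open>I\<close> is
  homogeneous of degree \<open>-1\<close>, Euler's relation gives \<open>2\<lambda> = -I(a) \<le> 0\<close> and the remaining diagonal
  entries of the Hessian, in which \<open>\<mu> > 0\<close> contributes positively at negative coordinates. If
  \<open>a\<^sub>j\<close> and \<open>a\<^sub>k\<close> are both negative, the tangent vector \<open>(a\<^sub>k - a\<^sub>j) a + e\<^sub>j - e\<^sub>k\<close> therefore violates the
  second-order necessary condition along the great circle through \<open>a\<close>.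
\<close>

subsection \<open>Partial fractions for the integral\<close>

text \<open>The index set is a parameter because partial fractions remove one factor at a time;
  \<open>I_fun\<close> comes from the full index set.\<close>

definition prod_integrand :: "'i set \<Rightarrow> ('i \<Rightarrow> real) \<Rightarrow> real \<Rightarrow> complex" where
  "prod_integrand S c t = (\<Prod>j\<in>S. 1 / (1 + \<i> * complex_of_real t * complex_of_real (c j)))"

definition prod_integral :: "'i set \<Rightarrow> ('i \<Rightarrow> real) \<Rightarrow> complex" where
  "prod_integral S c = (LINT t|lborel. prod_integrand S c t)"

lemma I_fun_eq_prod_integral: "I_fun a = Re (prod_integral UNIV (\<lambda>j. a $ j))"
  by (simp add: I_fun_def prod_integral_def prod_integrand_def)

lemma one_plus_i_mult_nonzero: "1 + \<i> * complex_of_real t * complex_of_real x \<noteq> 0"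
  by (simp add: complex_eq_iff)

lemma cmod_one_div_one_plus_i_mult:
  "cmod (1 / (1 + \<i> * complex_of_real t * complex_of_real x)) = 1 / sqrt (1 + (t * x)\<^sup>2)"
  by (simp add: norm_divide) (simp add: cmod_def)

lemma cmod_one_div_one_plus_i_mult_le_1: "cmod (1 / (1 + \<i> * complex_of_real t * complex_of_real x)) \<le> 1"
proof -
  have "1 \<le> sqrt (1 + (t * x)\<^sup>2)" by simp
  then show ?thesis unfolding cmod_one_div_one_plus_i_mult by (auto simp: divide_le_eq_1 add_pos_nonneg)
qed

text \<open>Rescaling t reduces both claims to the integral of 1 / (1 + t^2). The numerator
  \<open>c\<close> cancels the Jacobian 1 / |c| up to sign, and these signs are what survives in the
  integral of two factors.\<close>

lemma lorentz_integral:
  fixes c :: real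
  assumes "c \<noteq> 0"
  shows "integrable lborel (\<lambda>t. 1 / (1 + (t * c)\<^sup>2))"
    and "(LINT t|lborel. c / (1 + (t * c)\<^sup>2)) = pi * sgn c"
proof -
  let ?g = "\<lambda>t::real. 1 / (1 + t\<^sup>2)"
  have g: "integrable lborel ?g"
    using integrable_inverse_1_plus_square
    by (simp add: set_integrable_def inverse_eq_divide einterval_def)
  have gi: "(LINT t|lborel. ?g t) = pi"
    using LBINT_inverse_1_plus_square
    by (simp add: interval_lebesgue_integral_def set_lebesgue_integral_def inverse_eq_divide einterval_def)
  show int: "integrable lborel (\<lambda>t. 1 / (1 + (t * c)\<^sup>2))"
    using lborel_integrable_real_affine[OF g assms, of 0] by (simp add: mult.commute)
  have "pi = \<bar>c\<bar> * (LINT t|lborel. 1 / (1 + (t * c)\<^sup>2))"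
    using lborel_integral_real_affine[OF assms, of ?g 0] gi by (simp add: mult.commute)
  moreover have "(LINT t|lborel. c / (1 + (t * c)\<^sup>2)) = c * (LINT t|lborel. 1 / (1 + (t * c)\<^sup>2))"
    using integral_mult_right_zero[of lborel c "\<lambda>t. 1 / (1 + (t * c)\<^sup>2)"] by simp
  ultimately show "(LINT t|lborel. c / (1 + (t * c)\<^sup>2)) = pi * sgn c"
    using assms by (auto simp: sgn_if abs_if)
qed

text \<open>Two factors supply the decay: by 2xy <= x^2 + y^2 the product of their moduli is at most
  the mean of two Lorentzians. The remaining factors have modulus at most 1.\<close>

lemma integrable_prod_integrand:
  assumes "finite S" "card S \<ge> 2" "\<And>j. j \<in> S \<Longrightarrow> c j \<noteq> 0"
  shows "integrable lborel (prod_integrand S c)"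
proof -
  obtain j k where jk: "j \<in> S" "k \<in> S" "j \<noteq> k"
    using assms(1,2) by (metis card_le_Suc0_iff_eq not_less_eq_eq numeral_2_eq_2)
  let ?w = "\<lambda>t. (1 / (1 + (t * c j)\<^sup>2) + 1 / (1 + (t * c k)\<^sup>2)) / 2"
  have w: "integrable lborel ?w"
    using lorentz_integral(1)[of "c j"] lorentz_integral(1)[of "c k"] assms(3) jk by auto
  have meas: "prod_integrand S c \<in> borel_measurable lborel"
    unfolding prod_integrand_def by measurable
  have bound: "cmod (prod_integrand S c t) \<le> ?w t" for t
  proof -
    let ?f = "\<lambda>i. cmod (1 / (1 + \<i> * complex_of_real t * complex_of_real (c i)))"
    have eq: "S = insert j (insert k (S - {j,k}))" using jk by auto
    have "cmod (prod_integrand S c t) = prod ?f S"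
      by (simp add: prod_integrand_def prod_norm)
    also have "\<dots> = ?f j * (?f k * prod ?f (S - {j,k}))"
      by (subst eq) (use jk assms(1) in simp)
    also have "\<dots> \<le> ?f j * (?f k * 1)"
      by (intro mult_left_mono prod_le_1 conjI cmod_one_div_one_plus_i_mult_le_1) auto
    also have "\<dots> \<le> ((?f j)\<^sup>2 + (?f k)\<^sup>2) / 2"
      using sum_squares_bound[of "?f j" "?f k"] by (simp add: power2_eq_square)
    also have "\<dots> = ?w t"
      unfolding cmod_one_div_one_plus_i_mult by (simp add: power_divide)
    finally show ?thesis .
  qed
  show ?thesis
    by (rule Bochner_Integration.integrable_bound[OF w meas])
      (intro AE_I2, use bound in \<open>auto intro: order_trans[OF _ abs_ge_self]\<close>)
qed

text \<open>With x and y the denominators for j and k, the terms in t cancel in \<open>c j\<close> y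
  - \<open>c k\<close> x, leaving \<open>c j - c k\<close>; divide by xy and multiply by the other
  factors.\<close>

lemma prod_integrand_partial_fractions:
  assumes "finite S" "j \<in> S" "k \<in> S" "j \<noteq> k"
  shows "of_real (c j - c k) * prod_integrand S c t =
    of_real (c j) * prod_integrand (S - {k}) c t - of_real (c k) * prod_integrand (S - {j}) c t"
proof -
  let ?x = "1 + \<i> * complex_of_real t * complex_of_real (c j)"
  let ?y = "1 + \<i> * complex_of_real t * complex_of_real (c k)"
  let ?P = "prod_integrand (S - {j,k}) c t"
  have "S = insert j (insert k (S - {j,k}))" "S - {k} = insert j (S - {j,k})"
    "S - {j} = insert k (S - {j,k})" using assms by auto
  then have 1: "prod_integrand S c t = 1 / ?x * (1 / ?y * ?P)"
    "prod_integrand (S - {k}) c t = 1 / ?x * ?P" "prod_integrand (S - {j}) c t = 1 / ?y * ?P"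
    using assms unfolding prod_integrand_def
    by (metis (no_types, lifting) Diff_iff finite_Diff insertCI prod.insert)+
  have "?x \<noteq> 0" "?y \<noteq> 0" by (rule one_plus_i_mult_nonzero)+
  then have "of_real (c j - c k) * (1 / ?x * (1 / ?y)) =
     of_real (c j) * (1 / ?x) - of_real (c k) * (1 / ?y)"
    by (simp add: divide_simps) (simp add: algebra_simps)
  then have "of_real (c j - c k) * (1 / ?x * (1 / ?y)) * ?P =
     (of_real (c j) * (1 / ?x) - of_real (c k) * (1 / ?y)) * ?P" by (rule arg_cong)
  then show ?thesis unfolding 1 by (simp only: algebra_simps)
qed

text \<open>Three factors ensure that each term on the right keeps two, so that it is integrable and
  the integral may be split.\<close>

lemma prod_integral_partial_fractions:
  assumes "finite S" "card S \<ge> 3" "\<And>j. j \<in> S \<Longrightarrow> c j \<noteq> 0" "j \<in> S" "k \<in> S" "j \<noteq> k"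
  shows "of_real (c j - c k) * prod_integral S c =
    of_real (c j) * prod_integral (S - {k}) c - of_real (c k) * prod_integral (S - {j}) c"
proof -
  have i: "integrable lborel (prod_integrand (S - {i}) c)" if "i \<in> S" for i
    using assms that by (intro integrable_prod_integrand) auto
  have "of_real (c j - c k) * prod_integral S c =
     (LINT t|lborel. of_real (c j - c k) * prod_integrand S c t)"
    by (simp add: prod_integral_def)
  also have "\<dots> = (LINT t|lborel. of_real (c j) * prod_integrand (S - {k}) c t
                 - of_real (c k) * prod_integrand (S - {j}) c t)"
    using prod_integrand_partial_fractions[OF assms(1,4-6)] by simp
  also have "\<dots> = of_real (c j) * prod_integral (S - {k}) c - of_real (c k) * prod_integral (S - {j}) c"
    using i[OF assms(4)] i[OF assms(5)] by (simp add: prod_integral_def)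
  finally show ?thesis .
qed

text \<open>Single factors are not absolutely integrable, but the real part of c / (1 + itc) is the
  Lorentzian c / (1 + (tc)^2). Taking real parts before splitting the integral therefore rescues the
  case of two factors.\<close>

lemma Re_prod_integral_pair:
  assumes "j \<noteq> k" "c j \<noteq> 0" "c k \<noteq> 0"
  shows "(c j - c k) * Re (prod_integral {j,k} c) = pi * (sgn (c j) - sgn (c k))"
proof -
  have i: "integrable lborel (prod_integrand {j,k} c)"
    using assms by (intro integrable_prod_integrand) auto
  have re: "(c j - c k) * Re (prod_integrand {j,k} c t) =
     c j / (1 + (t * c j)\<^sup>2) - c k / (1 + (t * c k)\<^sup>2)" for t
  proof -
    have "of_real (c j - c k) * prod_integrand {j,k} c t =
      of_real (c j) * prod_integrand {j} c t - of_real (c k) * prod_integrand {k} c t"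
      using prod_integrand_partial_fractions[of "{j,k}" j k c t] assms(1)
      by (simp add: insert_Diff_if)
    from arg_cong[OF this, of Re] show ?thesis
      by (simp add: prod_integrand_def Re_divide power2_eq_square)
  qed
  have k: "integrable lborel (\<lambda>t. c i / (1 + (t * c i)\<^sup>2))" if "c i \<noteq> 0" for i
    using integrable_mult_right[OF lorentz_integral(1)[OF that], of "c i"] by simp
  have "(c j - c k) * Re (prod_integral {j,k} c) =
     (LINT t|lborel. (c j - c k) * Re (prod_integrand {j,k} c t))"
    using i by (simp add: prod_integral_def)
  also have "\<dots> = pi * (sgn (c j) - sgn (c k))"
    unfolding re using assms k[of j] k[of k]
    by (simp add: lorentz_integral(2) right_diff_distrib)
  finally show ?thesis .
qed

text \<open>Induction on the number of factors by partial fractions. If \<open>c j > 0\<close> and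
  \<open>c k < 0\<close>, both terms on the right are nonnegative and \<open>c j - c k\<close> is
  positive. If all signs agree, the right side is a difference with no evident sign; the vanishing
  clause is carried through the induction to settle this case.\<close>

lemma Re_prod_integral_nonneg:
  assumes "finite S" "card S \<ge> 2" "inj_on c S" "\<And>j. j \<in> S \<Longrightarrow> c j \<noteq> 0"
  shows "Re (prod_integral S c) \<ge> 0 \<and>
    ((\<forall>j\<in>S. \<forall>k\<in>S. c j * c k > 0) \<longrightarrow> Re (prod_integral S c) = 0)"
  using assms
proof (induction "card S" arbitrary: S rule: less_induct)
  case less
  note S = less.prems
  show ?case
  proof (cases "card S = 2")
    case True
    then obtain j k where S2: "S = {j,k}" "j \<noteq> k" by (meson card_2_iff)
    have ne: "c j \<noteq> c k" using S S2 by (auto simp: inj_on_def)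
    have eq: "(c j - c k) * Re (prod_integral S c) = pi * (sgn (c j) - sgn (c k))"
      using Re_prod_integral_pair[of j k c] S S2 by auto
    have "Re (prod_integral S c) = pi * (sgn (c j) - sgn (c k)) / (c j - c k)"
      using eq ne by (simp add: field_simps)
    moreover have "\<dots> \<ge> 0"
      using S(4)[of j] S(4)[of k] S2 by (auto simp: sgn_if divide_simps mult_less_0_iff)
    moreover have "sgn (c j) = sgn (c k)" if "c j * c k > 0"
      using that by (auto simp: zero_less_mult_iff sgn_if)
    ultimately show ?thesis using S2 by auto
  next
    case False
    then have c3: "card S \<ge> 3" using S by simp
    have rem: "Re (prod_integral (S - {i}) c) \<ge> 0 \<and>
       ((\<forall>j\<in>S-{i}. \<forall>k\<in>S-{i}. c j * c k > 0) \<longrightarrow> Re (prod_integral (S-{i}) c) = 0)" if "i \<in> S" for i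
    proof (rule less.hyps)
      show "card (S - {i}) < card S" using S that by (simp add: card_Diff1_less)
      show "2 \<le> card (S - {i})" using c3 S that by simp
    qed (use S in \<open>auto simp: inj_on_def\<close>)
    have eq: "(c j - c k) * Re (prod_integral S c) =
       c j * Re (prod_integral (S - {k}) c) - c k * Re (prod_integral (S - {j}) c)"
      if "j \<in> S" "k \<in> S" "j \<noteq> k" for j k
      using arg_cong[where f = Re, OF prod_integral_partial_fractions[OF S(1) c3 S(4) that]] by simp
    show ?thesis
    proof (cases "\<forall>j\<in>S. \<forall>k\<in>S. c j * c k > 0")
      case True
      obtain j k where jk: "j \<in> S" "k \<in> S" "j \<noteq> k"
        using S(1,2) by (metis card_le_Suc0_iff_eq not_less_eq_eq numeral_2_eq_2)
      have "c j \<noteq> c k" using jk S by (auto simp: inj_on_def)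
      moreover have "Re (prod_integral (S - {j}) c) = 0" "Re (prod_integral (S - {k}) c) = 0"
        using rem jk True by auto
      ultimately have "Re (prod_integral S c) = 0" using eq[OF jk] by simp
      then show ?thesis by simp
    next
      case False
      then obtain p q where pq: "p \<in> S" "q \<in> S" "c p * c q \<le> 0" by (auto simp: not_less)
      then have "c p * c q < 0" using S(4) by (simp add: less_le)
      then obtain j k where jk: "j \<in> S" "k \<in> S" "c j > 0" "c k < 0"
        using pq by (auto simp: mult_less_0_iff)
      then have "j \<noteq> k" by auto
      have "(c j - c k) * Re (prod_integral S c) \<ge> 0"
        unfolding eq[OF jk(1,2) \<open>j \<noteq> k\<close>] diff_ge_0_iff_ge
        using rem[OF jk(1)] rem[OF jk(2)] jk(3,4)
        by (intro order_trans[OF mult_nonpos_nonneg mult_nonneg_nonneg]) auto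
      then have "Re (prod_integral S c) \<ge> 0" using jk by (simp add: zero_le_mult_iff)
      then show ?thesis using False by blast
    qed
  qed
qed

lemma I_fun_scaleR:
  fixes a :: "real ^ 'n::finite"
  assumes "s > 0"
  shows "I_fun (s *\<^sub>R a) = I_fun a / s"
proof -
  have "(LINT t|lborel. prod_integrand UNIV (\<lambda>j. a $ j) t) =
     s *\<^sub>R (LINT t|lborel. prod_integrand UNIV (\<lambda>j. a $ j) (0 + s * t))"
    using lborel_integral_real_affine[of s "prod_integrand UNIV (\<lambda>j. a $ j)" 0] assms by simp
  also have "(\<lambda>t. prod_integrand UNIV (\<lambda>j. a $ j) (0 + s * t)) = prod_integrand UNIV (\<lambda>j. (s *\<^sub>R a) $ j)"
    by (simp add: prod_integrand_def mult_ac fun_eq_iff)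
  finally show ?thesis
    using assms by (simp add: I_fun_eq_prod_integral prod_integral_def)
qed

subsection \<open>Second-order calculus along lines and circles\<close>

text \<open>If \<open>D\<close> were positive, \<open>g'\<close> would vanish at \<open>x\<close>
  and be positive just to the right of it, so \<open>g\<close> would increase strictly
  there.\<close>

lemma second_derivative_nonpos_at_local_max:
  fixes g g' :: "real \<Rightarrow> real"
  assumes der: "\<forall>\<^sub>F s in nhds x. (g has_real_derivative g' s) (at s)"
    and der2: "(g' has_real_derivative D) (at x)"
    and max: "\<forall>\<^sub>F s in nhds x. g s \<le> g x"
  shows "D \<le> 0"
proof (rule ccontr)
  assume "\<not> D \<le> 0"
  obtain d where d: "d > 0" "\<And>s. \<bar>s - x\<bar> < d \<Longrightarrow> (g has_real_derivative g' s) (at s) \<and> g s \<le> g x"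
    using eventually_conj[OF der max] unfolding eventually_nhds_metric dist_real_def by auto
  have g0: "g' x = 0"
    using d by (intro DERIV_local_max[of g "g' x" x d]) (auto simp: abs_minus_commute)
  obtain e where e: "e > 0" "\<And>h. 0 < h \<Longrightarrow> h < e \<Longrightarrow> g' x < g' (x + h)"
    using DERIV_pos_inc_right[OF der2] \<open>\<not> D \<le> 0\<close> by auto
  define m where "m = min d e / 2"
  have m: "m > 0" "m < d" "m < e" using d e by (auto simp: m_def)
  have "g x < g (x + m)"
  proof (rule DERIV_pos_imp_increasing_open[where f = g and a = x and b = "x + m"])
    show "x < x + m" using m by simp
    fix s assume s: "x < s" "s < x + m"
    show "\<exists>y. (g has_real_derivative y) (at s) \<and> 0 < y"
      using d(2)[of s] e(2)[of "s - x"] s m g0 by (intro exI[of _ "g' s"]) auto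
  next
    show "continuous_on {x..x+m} g"
      using d(2) m by (intro continuous_at_imp_continuous_on ballI DERIV_isCont) force
  qed
  moreover have "g (x + m) \<le> g x" using d(2)[of "x + m"] m by auto
  ultimately show False by simp
qed

text \<open>The curve c(s) = cos s a + sin s v has c'(0) = v and c''(0) = -a, so f(c(s)) has second
  derivative \<open>F v v - f' a a\<close> at 0. The term \<open>f' a a\<close> accounts for the
  curvature of the constraint.\<close>

lemma second_order_condition_on_circle:
  fixes f :: "'a::real_normed_vector \<Rightarrow> real" and f' :: "'a \<Rightarrow> 'a \<Rightarrow>\<^sub>L real"
  assumes U: "open U" "a \<in> U"
    and f': "\<And>x. x \<in> U \<Longrightarrow> (f has_derivative f' x) (at x)"
    and f'': "(f' has_derivative F) (at a)"
    and max: "local_max_on M f a"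
    and curve: "\<And>s. cos s *\<^sub>R a + sin s *\<^sub>R v \<in> M"
  shows "F v v \<le> f' a a"
proof -
  define c where "c = (\<lambda>s. cos s *\<^sub>R a + sin s *\<^sub>R v)"
  define c' where "c' = (\<lambda>s. (- sin s) *\<^sub>R a + cos s *\<^sub>R v)"
  have c0: "c 0 = a" "c' 0 = v" by (auto simp: c_def c'_def)
  have dc: "(c has_derivative (\<lambda>h. h *\<^sub>R c' s)) (at s)" for s
    unfolding c_def c'_def
    by (auto intro!: derivative_eq_intros simp: algebra_simps)
  have dc': "(c' has_derivative (\<lambda>h. h *\<^sub>R (- a))) (at 0)"
    unfolding c'_def
    by (auto intro!: derivative_eq_intros simp: algebra_simps)
  have tc: "(c \<longlongrightarrow> a) (nhds 0)"
    using has_derivative_continuous[OF dc[of 0]] c0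
    by (simp add: isCont_def tendsto_nhds_iff)
  have inU: "\<forall>\<^sub>F s in nhds 0. c s \<in> U"
    using topological_tendstoD[OF tc U] .
  have "\<forall>\<^sub>F x in nhds a. x \<in> M \<longrightarrow> f x \<le> f a"
    using max unfolding local_max_on_def eventually_at_filter
    by (auto elim!: eventually_mono)
  from eventually_compose_filterlim[OF this tc] have max': "\<forall>\<^sub>F s in nhds 0. f (c s) \<le> f (c 0)"
    using curve by (simp add: c0 c_def)
  have der: "\<forall>\<^sub>F s in nhds 0. ((\<lambda>s. f (c s)) has_real_derivative f' (c s) (c' s)) (at s)"
    using inU
  proof eventually_elim
    case (elim s)
    show ?case
      using has_derivative_compose[OF dc[of s] f'[OF elim]]
      by (simp add: has_field_derivative_def blinfun.scaleR_right mult_commute_abs)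
  qed
  have "((\<lambda>s. f' (c s)) has_derivative (\<lambda>h. F (h *\<^sub>R c' 0))) (at 0)"
    using has_derivative_compose[OF dc[of 0]] f'' c0 by auto
  from blinfun.FDERIV[OF this dc']
  have "((\<lambda>s. f' (c s) (c' s)) has_derivative (\<lambda>h. f' a (h *\<^sub>R (- a)) + F (h *\<^sub>R v) v)) (at 0)"
    by (simp add: c0)
  moreover have "F (h *\<^sub>R v) = h *\<^sub>R F v" for h
    using has_derivative_linear[OF f''] by (simp add: linear_cmul)
  ultimately have "((\<lambda>s. f' (c s) (c' s)) has_derivative (\<lambda>h. (F v v - f' a a) * h)) (at 0)"
    by (simp add: blinfun.scaleR_right blinfun.scaleR_left blinfun.minus_right algebra_simps)
  then have der2: "((\<lambda>s. f' (c s) (c' s)) has_real_derivative (F v v - f' a a)) (at 0)"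
    by (simp only: has_field_derivative_def)
  show ?thesis
    using second_derivative_nonpos_at_local_max[OF der der2 max'] by simp
qed

text \<open>Both sides of the homogeneity relation are differentiated in s at s = 1.\<close>

lemma euler_homogeneous_first_order:
  fixes f :: "'a::real_normed_vector \<Rightarrow> real" and f' :: "'a \<Rightarrow> 'a \<Rightarrow>\<^sub>L real"
  assumes "(f has_derivative f' x) (at x)"
    and hom: "\<And>s. s > 0 \<Longrightarrow> f (s *\<^sub>R x) = f x / s"
  shows "f' x x = - f x"
proof -
  have "((\<lambda>s. s *\<^sub>R x) has_derivative (\<lambda>h. h *\<^sub>R x)) (at 1)"
    by (auto intro!: derivative_eq_intros)
  from has_derivative_compose[OF this, of f "f' x"] assms(1)
  have 1: "((\<lambda>s. f (s *\<^sub>R x)) has_real_derivative f' x x) (at 1)"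
    by (simp add: has_field_derivative_def blinfun.scaleR_right mult_commute_abs)
  have "((\<lambda>s. f x / s) has_real_derivative - f x) (at 1)"
    by (auto intro!: derivative_eq_intros)
  moreover have "\<forall>\<^sub>F s in nhds 1. f x / s = f (s *\<^sub>R x)"
    by (rule eventually_mono[OF eventually_nhds_in_open[of "{0<..}"]]) (auto simp: hom)
  ultimately have "((\<lambda>s. f (s *\<^sub>R x)) has_real_derivative - f x) (at 1)"
    by (subst (asm) DERIV_cong_ev[OF refl _ refl]) auto
  from DERIV_unique[OF 1 this] show ?thesis .
qed

text \<open>Differentiating the identity \<open>f' x x = - f x\<close> at \<open>a\<close> gives
  \<open>f' a u + F u a = - f' a u\<close>. The argument order is that of the product rule; no
  symmetry of \<open>F\<close> enters.\<close>

lemma euler_homogeneous_second_order: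
  fixes f :: "'a::real_normed_vector \<Rightarrow> real" and f' :: "'a \<Rightarrow> 'a \<Rightarrow>\<^sub>L real"
  assumes U: "open U" "a \<in> U"
    and f': "\<And>x. x \<in> U \<Longrightarrow> (f has_derivative f' x) (at x)"
    and f'': "(f' has_derivative F) (at a)"
    and hom: "\<And>s x. s > 0 \<Longrightarrow> f (s *\<^sub>R x) = f x / s"
  shows "F u a = - 2 * f' a u"
proof -
  have "((\<lambda>x. f' x x) has_derivative (\<lambda>h. f' a h + F h a)) (at a)"
    using blinfun.FDERIV[OF f'' has_derivative_ident] by simp
  moreover have "\<forall>\<^sub>F x in nhds a. f' x x = - f x"
    by (rule eventually_mono[OF eventually_nhds_in_open[OF U]])
      (intro euler_homogeneous_first_order f' hom)
  ultimately have "((\<lambda>x. - f x) has_derivative (\<lambda>h. f' a h + F h a)) (at a)"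
    using eventually_nhds_x_imp_x
    by (intro has_derivative_transform_eventually[where f = "\<lambda>x. f' x x" and g = "\<lambda>x. - f x"])
      (auto simp: eventually_at_filter elim!: eventually_mono)
  moreover have "((\<lambda>x. - f x) has_derivative (\<lambda>h. - f' a h)) (at a)"
    using f'[OF U(2)] by (rule has_derivative_minus)
  ultimately have "(\<lambda>h. f' a h + F h a) = (\<lambda>h. - f' a h)"
    by (rule has_derivative_unique)
  from fun_cong[OF this, of u] show ?thesis by simp
qed

text \<open>The x-derivative of the separated identity at x = 0 is \<open>h y\<close> on the left
  and the derivative of \<open>\<phi>\<close> at 0 on the right. Hence \<open>h\<close> is constant
  near 0, and the claim is that its derivative at 0 vanishes. No regularity of \<open>\<phi>\<close>
  or \<open>\<psi>\<close> has to be assumed.\<close>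

lemma mixed_derivative_of_separated:
  fixes f :: "'a::real_normed_vector \<Rightarrow> real" and f' :: "'a \<Rightarrow> 'a \<Rightarrow>\<^sub>L real"
  assumes U: "open U" "p \<in> U"
    and f': "\<And>x. x \<in> U \<Longrightarrow> (f has_derivative f' x) (at x)"
    and f'': "(f' has_derivative F) (at p)"
    and eps: "\<epsilon> > 0"
    and sep: "\<And>x y. \<bar>x\<bar> < \<epsilon> \<Longrightarrow> \<bar>y\<bar> < \<epsilon> \<Longrightarrow> (c + x - y) * f (p + x *\<^sub>R u + y *\<^sub>R v) = \<phi> x - \<psi> y"
  shows "f' p u - f' p v = c * F v u"
proof -
  define h where "h = (\<lambda>y. f (p + y *\<^sub>R v) + (c - y) * f' (p + y *\<^sub>R v) u)"
  have line: "((\<lambda>t. q + t *\<^sub>R w) has_derivative (\<lambda>t. t *\<^sub>R w)) (at s)" for q w :: 'a and s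
    by (auto intro!: derivative_eq_intros)
  have "((\<lambda>y. p + y *\<^sub>R v) \<longlongrightarrow> p) (nhds 0)"
    by (auto intro!: tendsto_eq_intros filterlim_ident)
  from topological_tendstoD[OF this U] have inU: "\<forall>\<^sub>F y in nhds 0. p + y *\<^sub>R v \<in> U" .
  moreover have small: "\<forall>\<^sub>F y in nhds 0. \<bar>y\<bar> < \<epsilon>"
    unfolding eventually_nhds_metric using eps by (auto simp: dist_real_def)
  ultimately have "\<forall>\<^sub>F y in nhds 0. (\<phi> has_real_derivative h y) (at 0)"
  proof eventually_elim
    case (elim y)
    have "((\<lambda>x. f (p + y *\<^sub>R v + x *\<^sub>R u)) has_derivative (\<lambda>t. f' (p + y *\<^sub>R v) (t *\<^sub>R u))) (at 0)"
      using has_derivative_compose[OF line[of "p + y *\<^sub>R v" u 0]] f'[OF elim(1)] by simp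
    then have "((\<lambda>x. f (p + x *\<^sub>R u + y *\<^sub>R v)) has_real_derivative f' (p + y *\<^sub>R v) u) (at 0)"
      by (simp add: has_field_derivative_def blinfun.scaleR_right mult_commute_abs add_ac)
    then have "((\<lambda>x. (c + x - y) * f (p + x *\<^sub>R u + y *\<^sub>R v) + \<psi> y) has_real_derivative h y) (at 0)"
      by (auto intro!: derivative_eq_intros simp: h_def)
    moreover have "\<forall>\<^sub>F x in nhds 0. (c + x - y) * f (p + x *\<^sub>R u + y *\<^sub>R v) + \<psi> y = \<phi> x"
      using small by eventually_elim (use elim sep in auto)
    ultimately show ?case
      by (subst (asm) DERIV_cong_ev[OF refl _ refl]) auto
  qed
  moreover from this have "(\<phi> has_real_derivative h 0) (at 0)"
    by (rule eventually_nhds_x_imp_x)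
  ultimately have "\<forall>\<^sub>F y in nhds 0. h y = h 0"
    by (auto elim!: eventually_mono dest: DERIV_unique)
  then have h1: "(h has_real_derivative 0) (at 0)"
    by (subst DERIV_cong_ev[OF refl _ refl]) auto
  have d1: "((\<lambda>y. f (p + y *\<^sub>R v)) has_real_derivative f' p v) (at 0)"
    using has_derivative_compose[OF line[of p v 0], of f "f' p"] f'[OF U(2)]
    by (simp add: has_field_derivative_def blinfun.scaleR_right mult_commute_abs)
  have "((\<lambda>y. f' (p + y *\<^sub>R v)) has_derivative (\<lambda>t. F (t *\<^sub>R v))) (at 0)"
    using has_derivative_compose[OF line[of p v 0], of f' F] f'' by simp
  from blinfun.FDERIV[OF this has_derivative_const[of u]]
  have "((\<lambda>y. f' (p + y *\<^sub>R v) u) has_derivative (\<lambda>t. F (t *\<^sub>R v) u)) (at 0)"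
    by simp
  moreover have "F (h *\<^sub>R v) = h *\<^sub>R F v" for h
    using has_derivative_linear[OF f''] by (simp add: linear_cmul)
  ultimately have d2: "((\<lambda>y. f' (p + y *\<^sub>R v) u) has_real_derivative F v u) (at 0)"
    by (simp add: has_field_derivative_def blinfun.scaleR_left mult_commute_abs)
  have "(h has_real_derivative f' p v - f' p u + c * F v u) (at 0)"
    unfolding h_def using d1 d2 by (auto intro!: derivative_eq_intros)
  from DERIV_unique[OF this h1] show ?thesis by simp
qed

text \<open>The entries of \<open>w\<close> are positive and pairwise distinct, so each of the
  finitely many conditions is affine in s with nonzero slope and fails for only one s.\<close>

lemma perturb_nonzero_distinct:
  fixes a :: "real ^ 'n::finite"
  obtains w :: "real ^ 'n" where
    "\<forall>\<^sub>F s in at 0. (\<forall>j. (a + s *\<^sub>R w) $ j \<noteq> 0) \<and> inj (\<lambda>j. (a + s *\<^sub>R w) $ j)"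
proof -
  obtain g :: "'n \<Rightarrow> nat" where g: "inj g"
    using finite_imp_inj_to_nat_seg[of "UNIV :: 'n set"] by auto
  define w :: "real ^ 'n" where "w = (\<chi> j. 1 + real (g j))"
  have ne: "\<forall>\<^sub>F s in at 0. \<alpha> + s * \<beta> \<noteq> 0" if "\<beta> \<noteq> 0" for \<alpha> \<beta> :: real
  proof -
    have "\<forall>\<^sub>F s in at 0. s \<noteq> - \<alpha> / \<beta>" by (rule eventually_neq_at_within)
    then show ?thesis by eventually_elim (use that in \<open>auto simp: field_simps\<close>)
  qed
  have "\<forall>\<^sub>F s in at 0. \<forall>j. (a + s *\<^sub>R w) $ j \<noteq> 0"
    by (intro eventually_all_finite) (use ne[of "w $ _" "a $ _"] in \<open>simp add: w_def add_pos_nonneg\<close>)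
  moreover have "\<forall>\<^sub>F s in at 0. \<forall>j k. j \<noteq> k \<longrightarrow> (a + s *\<^sub>R w) $ j \<noteq> (a + s *\<^sub>R w) $ k"
  proof (intro eventually_all_finite)
    fix j k
    show "\<forall>\<^sub>F s in at 0. j \<noteq> k \<longrightarrow> (a + s *\<^sub>R w) $ j \<noteq> (a + s *\<^sub>R w) $ k"
    proof (cases "j = k")
      case False
      then have "w $ j - w $ k \<noteq> 0" using g by (auto simp: w_def inj_def)
      from ne[OF this, of "a $ j - a $ k"] show ?thesis
        by eventually_elim (simp add: algebra_simps)
    qed simp
  qed
  ultimately have "\<forall>\<^sub>F s in at 0. (\<forall>j. (a + s *\<^sub>R w) $ j \<noteq> 0) \<and> inj (\<lambda>j. (a + s *\<^sub>R w) $ j)"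
    by eventually_elim (auto simp: inj_def)
  then show ?thesis by (rule that)
qed

subsection \<open>The Hessian of the integral\<close>

text \<open>
  By partial fractions, \<open>(a\<^sub>j - a\<^sub>k) I(a)\<close> is a function not involving \<open>a\<^sub>k\<close> minus a function
  not involving \<open>a\<^sub>j\<close>.
\<close>

lemma I_fun_separated:
  fixes p :: "real ^ 'n::finite"
  assumes "CARD('n) \<ge> 3" "\<And>i. p $ i \<noteq> 0" "j \<noteq> k"
  obtains \<epsilon> \<phi> \<psi> where "\<epsilon> > 0"
    "\<And>x y. \<bar>x\<bar> < \<epsilon> \<Longrightarrow> \<bar>y\<bar> < \<epsilon> \<Longrightarrow>
      (p $ j - p $ k + x - y) * I_fun (p + x *\<^sub>R axis j 1 + y *\<^sub>R axis k 1) = \<phi> x - \<psi> y"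
proof -
  define J where "J = (\<lambda>l q. Re (prod_integral (UNIV - {l}) (\<lambda>i. (q :: real ^ 'n) $ i)))"
  \<comment> \<open>Shifts smaller than this keep coordinates j and k nonzero, as partial fractions
    require.\<close>
  define \<epsilon> where "\<epsilon> = min \<bar>p $ j\<bar> \<bar>p $ k\<bar>"
  show ?thesis
  proof
    show "\<epsilon> > 0" using assms(2) by (simp add: \<epsilon>_def)
    fix x y assume xy: "\<bar>x\<bar> < \<epsilon>" "\<bar>y\<bar> < \<epsilon>"
    define q where "q = p + x *\<^sub>R axis j 1 + y *\<^sub>R axis k 1"
    have qj: "q $ j = p $ j + x" and qk: "q $ k = p $ k + y"
      using assms(3) by (auto simp: q_def axis_def)
    have qi: "q $ i = p $ i" if "i \<noteq> j" "i \<noteq> k" for i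
      using that by (simp add: q_def axis_def)
    have nz: "q $ i \<noteq> 0" for i
      using xy assms(2)[of i] qi[of i] qj qk by (cases "i = j"; cases "i = k") (auto simp: \<epsilon>_def)
    \<comment> \<open>\<open>J k\<close> omits the factor of index k, so it does not see the shift
      by y; likewise \<open>J j\<close> does not see x.\<close>
    have "J k q = J k (p + x *\<^sub>R axis j 1)"
      unfolding J_def prod_integral_def prod_integrand_def
      by (intro arg_cong[of _ _ Re] Bochner_Integration.integral_cong refl prod.cong)
        (auto simp: q_def axis_def)
    moreover have "J j q = J j (p + y *\<^sub>R axis k 1)"
      unfolding J_def prod_integral_def prod_integrand_def
      by (intro arg_cong[of _ _ Re] Bochner_Integration.integral_cong refl prod.cong)
        (auto simp: q_def axis_def)
    moreover have "(q $ j - q $ k) * I_fun q = q $ j * J k q - q $ k * J j q"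
      using arg_cong[where f = Re, OF prod_integral_partial_fractions[of UNIV "\<lambda>i. q $ i" j k]]
        assms(1,3) nz
      by (simp add: I_fun_eq_prod_integral J_def)
    moreover have "p $ j - p $ k + x - y = q $ j - q $ k"
      by (simp add: qj qk)
    ultimately have "(p $ j - p $ k + x - y) * I_fun q =
        q $ j * J k (p + x *\<^sub>R axis j 1) - q $ k * J j (p + y *\<^sub>R axis k 1)"
      by (simp only:)
    then show "(p $ j - p $ k + x - y) * I_fun q =
        (p $ j + x) * J k (p + x *\<^sub>R axis j 1) - (p $ k + y) * J j (p + y *\<^sub>R axis k 1)"
      by (simp only: qj qk)
  qed
qed

lemma tendsto_line:
  fixes a w :: "'a::real_normed_vector"
  assumes "isCont g a"
  shows "((\<lambda>s. g (a + s *\<^sub>R w)) \<longlongrightarrow> g a) (at 0)"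
  by (rule isCont_tendsto_compose[OF assms]) (auto intro!: tendsto_eq_intros)

text \<open>Where all coordinates are nonzero this is \<open>mixed_derivative_of_separated\<close>
  with c = x_j - x_k. The defect \<open>E\<close> is continuous and vanishes at nearby generic
  points on a line through \<open>x\<close>, hence at \<open>x\<close>.\<close>

lemma I_fun_euler_poisson_darboux:
  fixes x :: "real ^ 'n::finite" and f' :: "real ^ 'n \<Rightarrow> (real ^ 'n) \<Rightarrow>\<^sub>L real"
    and f'' :: "real ^ 'n \<Rightarrow> (real ^ 'n) \<Rightarrow>\<^sub>L ((real ^ 'n) \<Rightarrow>\<^sub>L real)"
  assumes card: "CARD('n) \<ge> 3" and U: "open U" "x \<in> U"
    and f': "\<And>x. x \<in> U \<Longrightarrow> (I_fun has_derivative f' x) (at x)"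
    and f'': "\<And>x. x \<in> U \<Longrightarrow> (f' has_derivative f'' x) (at x)"
    and cont: "continuous_on U f''"
    and jk: "j \<noteq> k"
  shows "f' x (axis j 1) - f' x (axis k 1) = (x $ j - x $ k) * f'' x (axis k 1) (axis j 1)"
proof -
  define E where "E = (\<lambda>x. f' x (axis j 1) - f' x (axis k 1)
    - (x $ j - x $ k) * f'' x (axis k 1) (axis j 1))"
  obtain w where w: "\<forall>\<^sub>F s in at 0. (\<forall>j. (x + s *\<^sub>R w) $ j \<noteq> 0) \<and> inj (\<lambda>j. (x + s *\<^sub>R w) $ j)"
    by (rule perturb_nonzero_distinct)
  have "isCont f' x" "isCont f'' x"
    using has_derivative_continuous[OF f''[OF U(2)]] cont U by (auto simp: continuous_on_eq_continuous_at)
  then have "isCont E x"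
    unfolding E_def by (intro continuous_intros)
  then have lim: "((\<lambda>s. E (x + s *\<^sub>R w)) \<longlongrightarrow> E x) (at 0)" by (rule tendsto_line)
  have "\<forall>\<^sub>F s in at 0. x + s *\<^sub>R w \<in> U"
    using topological_tendstoD[OF tendsto_line[OF continuous_ident] U] .
  then have "\<forall>\<^sub>F s in at 0. E (x + s *\<^sub>R w) = 0"
    using w
  proof eventually_elim
    case (elim s)
    define p where "p = x + s *\<^sub>R w"
    have p: "p \<in> U" "\<And>i. p $ i \<noteq> 0" using elim by (auto simp: p_def)
    obtain \<epsilon> \<phi> \<psi> where "\<epsilon> > 0" and
      "\<And>x y. \<bar>x\<bar> < \<epsilon> \<Longrightarrow> \<bar>y\<bar> < \<epsilon> \<Longrightarrow>
      (p $ j - p $ k + x - y) * I_fun (p + x *\<^sub>R axis j 1 + y *\<^sub>R axis k 1) = \<phi> x - \<psi> y"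
      using I_fun_separated[OF card p(2) jk] by blast
    from mixed_derivative_of_separated[OF U(1) p(1) f' f''[OF p(1)] this]
    show ?case by (simp add: E_def p_def)
  qed
  then have "((\<lambda>s. E (x + s *\<^sub>R w)) \<longlongrightarrow> 0) (at 0)" by (rule tendsto_eventually)
  with lim have "E x = 0" using LIM_unique by blast
  then show ?thesis by (simp add: E_def)
qed

text \<open>
  The points with nonzero distinct coordinates, where partial fractions apply, are dense, so
  continuity suffices.
\<close>

lemma I_fun_nonneg:
  fixes a :: "real ^ 'n::finite"
  assumes "CARD('n) \<ge> 2" "isCont I_fun a"
  shows "I_fun a \<ge> 0"
proof -
  obtain w where w: "\<forall>\<^sub>F s in at 0. (\<forall>j. (a + s *\<^sub>R w) $ j \<noteq> 0) \<and> inj (\<lambda>j. (a + s *\<^sub>R w) $ j)"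
    by (rule perturb_nonzero_distinct)
  then have "\<forall>\<^sub>F s in at 0. I_fun (a + s *\<^sub>R w) \<ge> 0"
  proof eventually_elim
    case (elim s)
    then show ?case
      using Re_prod_integral_nonneg[of UNIV "\<lambda>j. (a + s *\<^sub>R w) $ j"] assms(1)
      by (simp only: I_fun_eq_prod_integral finite simp_thms)
  qed
  from tendsto_lowerbound[OF tendsto_line[OF assms(2)] this] show ?thesis by simp
qed

text \<open>At \<open>x\<close> itself the Euler-Poisson-Darboux relation only says that the two
  first derivatives agree. Moving by h along e_k makes the coordinate difference -h; dividing by h
  and letting h tend to 0 gives \<open>f'' x ?ek (?ej - ?ek) = - G x\<close>.\<close>

lemma I_fun_second_derivative_equal_coords:
  fixes x :: "real ^ 'n::finite" and f' :: "real ^ 'n \<Rightarrow> (real ^ 'n) \<Rightarrow>\<^sub>L real"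
    and f'' :: "real ^ 'n \<Rightarrow> (real ^ 'n) \<Rightarrow>\<^sub>L ((real ^ 'n) \<Rightarrow>\<^sub>L real)"
  assumes card: "CARD('n) \<ge> 3" and U: "open U" "x \<in> U"
    and f': "\<And>x. x \<in> U \<Longrightarrow> (I_fun has_derivative f' x) (at x)"
    and f'': "\<And>x. x \<in> U \<Longrightarrow> (f' has_derivative f'' x) (at x)"
    and cont: "continuous_on U f''"
    and jk: "j \<noteq> k" "x $ j = x $ k"
  shows "f'' x (axis k 1) (axis k 1) = 2 * f'' x (axis k 1) (axis j 1)"
proof -
  let ?ej = "axis j 1 :: real ^ 'n" and ?ek = "axis k 1 :: real ^ 'n"
  define G where "G = (\<lambda>x. f'' x ?ek ?ej)"
  define q where "q = (\<lambda>h. f' (x + h *\<^sub>R ?ek) (?ej - ?ek))"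
  have epd: "f' y ?ej - f' y ?ek = (y $ j - y $ k) * G y" if "y \<in> U" for y
    unfolding G_def using I_fun_euler_poisson_darboux[OF card U(1) that f' f'' cont jk(1)] .
  have "((\<lambda>h. x + h *\<^sub>R ?ek) has_derivative (\<lambda>h. h *\<^sub>R ?ek)) (at 0)"
    by (auto intro!: derivative_eq_intros)
  from has_derivative_compose[OF this, of f' "f'' x"]
  have "((\<lambda>h. f' (x + h *\<^sub>R ?ek)) has_derivative (\<lambda>h. f'' x (h *\<^sub>R ?ek))) (at 0)"
    using f''[OF U(2)] by simp
  from blinfun.FDERIV[OF this has_derivative_const[of "?ej - ?ek"]]
  have "(q has_real_derivative f'' x ?ek (?ej - ?ek)) (at 0)"
    by (simp add: q_def has_field_derivative_def blinfun.scaleR_right blinfun.scaleR_left mult_commute_abs)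
  then have 1: "((\<lambda>h. (q h - q 0) / h) \<longlongrightarrow> f'' x ?ek (?ej - ?ek)) (at 0)"
    by (simp add: DERIV_def)
  have "\<forall>\<^sub>F h in at 0. x + h *\<^sub>R ?ek \<in> U"
    using topological_tendstoD[OF tendsto_line[OF continuous_ident] U] .
  moreover have "\<forall>\<^sub>F h in at 0. h \<noteq> (0::real)"
    by (rule eventually_neq_at_within)
  ultimately have ev: "\<forall>\<^sub>F h in at 0. - G (x + h *\<^sub>R ?ek) = (q h - q 0) / h"
  proof eventually_elim
    case (elim h)
    have "q 0 = 0" using epd[OF U(2)] jk by (simp add: q_def blinfun.diff_right)
    moreover have "q h = - h * G (x + h *\<^sub>R ?ek)"
      using epd[OF elim(1)] jk by (simp add: q_def blinfun.diff_right axis_def)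
    ultimately show ?case using elim by simp
  qed
  have "isCont f'' x" using cont U by (auto simp: continuous_on_eq_continuous_at)
  then have "isCont (\<lambda>y. - G y) x" unfolding G_def by (intro continuous_intros)
  from tendsto_line[OF this] have "((\<lambda>h. (q h - q 0) / h) \<longlongrightarrow> - G x) (at 0)"
    by (rule Lim_transform_eventually[OF _ ev])
  from LIM_unique[OF 1 this] show ?thesis by (simp add: G_def blinfun.diff_right)
qed

section \<open>Coordinate expansions and great circles in the constraint set\<close>

lemma vec_eq_sum_axis: "(x :: real ^ 'n::finite) = (\<Sum>i\<in>UNIV. x $ i *\<^sub>R axis i 1)"
  using basis_expansion[of x] by (simp add: scalar_mult_eq_scaleR)

lemma great_circle_in_M_set:
  fixes a v :: "real ^ 'n::finite"
  assumes "a \<in> M_set" "(\<Sum>j\<in>UNIV. v $ j) = 0" "a \<bullet> v = 0" "norm v = 1"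
  shows "cos s *\<^sub>R a + sin s *\<^sub>R v \<in> M_set"
proof -
  have M: "y \<in> M_set \<longleftrightarrow> (\<Sum>j\<in>UNIV. y $ j) = 0 \<and> y \<bullet> y = 1" for y :: "real ^ 'n"
    by (simp add: M_set_def inner_vec_def power2_eq_square)
  have "v \<bullet> v = 1" using assms(4) by (simp add: norm_eq_1)
  moreover have "a \<bullet> a = 1" "(\<Sum>j\<in>UNIV. a $ j) = 0" "v \<bullet> a = 0"
    using assms(1,3) by (simp_all add: M inner_commute)
  moreover have "(\<Sum>j\<in>UNIV. (cos s *\<^sub>R a + sin s *\<^sub>R v) $ j) =
      cos s * (\<Sum>j\<in>UNIV. a $ j) + sin s * (\<Sum>j\<in>UNIV. v $ j)"
    by (simp add: sum.distrib sum_distrib_left)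
  moreover have "cos s * cos s + sin s * sin s = 1"
    using sin_cos_squared_add[of s] by (simp add: power2_eq_square)
  ultimately show ?thesis
    using assms(2,3) by (simp add: M inner_add_left inner_add_right)
qed

lemma blinfun_apply_eq_sum_axis:
  fixes T :: "(real ^ 'n::finite) \<Rightarrow>\<^sub>L 'b::real_normed_vector"
  shows "T x = (\<Sum>i\<in>UNIV. x $ i *\<^sub>R T (axis i 1))"
  by (subst vec_eq_sum_axis[of x]) (simp add: blinfun.sum_right blinfun.scaleR_right)

section \<open>Negative coordinates at a maximum with positive multiplier\<close>

theorem theorem3p1:
  fixes a :: "real ^ 'n::finite" and lam mu :: real
  assumes "CARD('n) \<ge> 2"
    and "smooth_local_max_on M_set I_fun a"
    and "\<And>j. partial_deriv j I_fun a = 2 * lam * (a $ j) + mu"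
    and "mu > 0"
  shows "card {j. a $ j < 0} = 1"
proof -
  let ?e = "\<lambda>j. axis j 1 :: real ^ 'n"
  obtain U f' f'' where U: "open U" "a \<in> U"
    and f': "\<And>x. x \<in> U \<Longrightarrow> (I_fun has_derivative blinfun_apply (f' x)) (at x)"
    and f'': "\<And>x. x \<in> U \<Longrightarrow> (f' has_derivative blinfun_apply (f'' x)) (at x)"
    and cont: "continuous_on U f''" and max: "local_max_on M_set I_fun a"
    using assms(2) unfolding smooth_local_max_on_def C2_on_def by blast
  have aM: "a \<in> M_set" using max by (simp add: local_max_on_def)
  then have sum0: "(\<Sum>i\<in>UNIV. a $ i) = 0" and aa: "a \<bullet> a = 1"
    by (simp_all add: M_set_def inner_vec_def power2_eq_square)
  have sum_axis: "(\<Sum>i\<in>UNIV. ?e p $ i) = 1" for p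
    by (simp add: axis_def)
  have "\<exists>j. a $ j < 0"
  proof (rule ccontr)
    assume "\<nexists>j. a $ j < 0"
    then have "\<forall>i\<in>UNIV. a $ i = 0"
      using sum_nonneg_eq_0_iff[of UNIV "\<lambda>i. a $ i"] sum0 by (auto simp: not_less)
    then have "a = 0" by (simp add: vec_eq_iff)
    then show False using aa by simp
  qed
  then obtain j0 where j0: "a $ j0 < 0" by blast
  have grad: "f' a (?e j) = 2 * lam * (a $ j) + mu" for j
  proof -
    have "((\<lambda>s. a + s *\<^sub>R ?e j) has_derivative (\<lambda>s. s *\<^sub>R ?e j)) (at 0)"
      by (auto intro!: derivative_eq_intros)
    from has_derivative_compose[OF this, of I_fun "f' a"]
    have "((\<lambda>s. I_fun (a + s *\<^sub>R ?e j)) has_real_derivative f' a (?e j)) (at 0)"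
      using f'[OF U(2)] by (simp add: has_field_derivative_def blinfun.scaleR_right mult_commute_abs)
    then show ?thesis
      using assms(3)[of j] by (simp add: partial_deriv_def DERIV_imp_deriv)
  qed
  \<comment> \<open>Pairing the multiplier equation with \<open>a\<close> removes \<open>mu\<close>,
    since the coordinates sum to 0 and their squares to 1.\<close>
  have grad_a: "f' a a = 2 * lam"
  proof -
    have "f' a a = 2 * lam * (\<Sum>i\<in>UNIV. a $ i * a $ i) + mu * (\<Sum>i\<in>UNIV. a $ i)"
      by (simp add: blinfun_apply_eq_sum_axis[of "f' a" a] grad sum_distrib_left sum.distrib algebra_simps)
    then show ?thesis using sum0 aa by (simp add: inner_vec_def)
  qed
  have Ia: "I_fun a = - 2 * lam"
    using euler_homogeneous_first_order[of I_fun f' a, OF f'[OF U(2)] I_fun_scaleR] grad_a by simp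
  have lam: "lam \<le> 0"
    using I_fun_nonneg[OF assms(1) has_derivative_continuous[OF f'[OF U(2)]]] Ia by simp
  \<comment> \<open>The circle condition applies to unit tangent vectors; quadratic scaling extends
    it to all tangent vectors.\<close>
  have second: "f'' a v v \<le> 2 * lam * (v \<bullet> v)" if v: "(\<Sum>i\<in>UNIV. v $ i) = 0" "a \<bullet> v = 0" for v
  proof (cases "v = 0")
    case False
    define u where "u = (1 / norm v) *\<^sub>R v"
    have "v = norm v *\<^sub>R u" "norm u = 1" using False by (simp_all add: u_def)
    have "(\<Sum>i\<in>UNIV. u $ i) = 0" "a \<bullet> u = 0"
      using v by (simp_all add: u_def flip: sum_divide_distrib)
    from second_order_condition_on_circle[OF U f' f''[OF U(2)] max great_circle_in_M_set[OF aM this \<open>norm u = 1\<close>]]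
    have "f'' a u u \<le> 2 * lam" by (simp add: grad_a)
    then have "(norm v)\<^sup>2 * f'' a u u \<le> (norm v)\<^sup>2 * (2 * lam)" by (intro mult_left_mono) auto
    moreover have "f'' a v v = (norm v)\<^sup>2 * f'' a u u"
      by (subst (1 2) \<open>v = norm v *\<^sub>R u\<close>)
        (simp only: blinfun.scaleR_right blinfun.scaleR_left real_scaleR_def power2_eq_square mult.assoc)
    ultimately show ?thesis by (simp add: power2_norm_eq_inner mult.commute)
  qed simp
  have row: "f'' a u a = - 2 * f' a u" for u
    by (intro euler_homogeneous_second_order[OF U f' f''[OF U(2)]] I_fun_scaleR)

  have "j = k" if neg: "a $ j < 0" "a $ k < 0" for j k
  proof (rule ccontr)
    assume jk: "j \<noteq> k"
    \<comment> \<open>The zero sum forces a positive coordinate besides the two negative ones,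
      giving the three factors needed for partial fractions.\<close>
    have card: "CARD('n) \<ge> 3"
    proof -
      have "\<exists>l. a $ l > 0"
      proof (rule ccontr)
        assume "\<nexists>l. a $ l > 0"
        then have "\<forall>i\<in>UNIV. - a $ i = 0"
          using sum_nonneg_eq_0_iff[of UNIV "\<lambda>i. - a $ i"] sum0 by (auto simp: not_less sum_negf)
        then show False using neg(1) by auto
      qed
      then obtain l where "a $ l > 0" by blast
      then have "l \<noteq> j" "l \<noteq> k" using neg by auto
      then have "card {j,k,l} = 3" using jk by simp
      then show ?thesis by (metis card_mono finite_class.finite_UNIV subset_UNIV)
    qed
    define H where "H = (\<lambda>p q. f'' a (?e p) (?e q))"
    have H_ne: "H p q = 2 * lam" if "a $ p \<noteq> a $ q" for p q
    proof -
      have "f' a (?e q) - f' a (?e p) = (a $ q - a $ p) * H p q"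
        unfolding H_def using that
        by (intro I_fun_euler_poisson_darboux[OF card U f' f'' cont]) auto
      moreover have "f' a (?e q) - f' a (?e p) = (a $ q - a $ p) * (2 * lam)"
        by (simp add: grad algebra_simps)
      ultimately show ?thesis using that by simp
    qed
    have H_eq: "H p p = 2 * H p q" if "a $ p = a $ q" "p \<noteq> q" for p q
      unfolding H_def using that
      by (intro I_fun_second_derivative_equal_coords[OF card U f' f'' cont]) auto
    \<comment> \<open>The multiplicity of the value \<open>a $ p\<close> among the
      coordinates.\<close>
    define m where "m = (\<lambda>p. real (card {i. a $ i = a $ p}))"
    \<comment> \<open>Euler's relation for the homogeneous gradient determines the diagonal of the Hessian from
      the off-diagonal entries.\<close>
    have H_diag: "(m p + 1) * (H p p / 2 - 2 * lam) = - 6 * lam - 2 * mu / a $ p"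
      if "a $ p \<noteq> 0" for p
    proof -
      let ?G = "{i. a $ i = a $ p}"
      \<comment> \<open>The entry \<open>H p i\<close> is \<open>H p p / 2\<close> for another index
        with the same coordinate and \<open>2 * lam\<close> for a different coordinate. The last
        summand restores the missing half at i = p.\<close>
      have split: "a $ i * H p i = 2 * lam * a $ i
          + (if a $ i = a $ p then a $ p * (H p p / 2 - 2 * lam) else 0)
          + (if i = p then a $ p * (H p p / 2) else 0)" for i
      proof -
        consider "i = p" | "i \<noteq> p" "a $ p = a $ i" | "a $ p \<noteq> a $ i" by blast
        then show ?thesis
        proof cases
          case 2
          then have "H p p / 2 = H p i" using H_eq[of p i] by simp
          then show ?thesis using 2 by (simp add: right_diff_distrib)
        next
          case 3
          then have "i \<noteq> p" by blast
          then show ?thesis using 3 H_ne[OF 3] by simp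
        qed (simp add: right_diff_distrib)
      qed
      have "f'' a (?e p) a = (\<Sum>i\<in>UNIV. a $ i * H p i)"
        by (simp add: blinfun_apply_eq_sum_axis[of "f'' a (?e p)" a] H_def)
      also have "\<dots> = 2 * lam * (\<Sum>i\<in>UNIV. a $ i) + m p * (a $ p * (H p p / 2 - 2 * lam))
          + a $ p * (H p p / 2)"
        unfolding split by (simp add: sum.distrib sum_distrib_left sum.If_cases m_def)
      finally have "m p * (a $ p * (H p p / 2 - 2 * lam)) + a $ p * (H p p / 2)
          = - 2 * (2 * lam * a $ p + mu)"
        using sum0 row[of "?e p"] by (simp add: grad)
      then show ?thesis using that by (simp add: field_simps)
    qed
    \<comment> \<open>For equal negative coordinates e_p - e_q is tangent with squared norm 2, and
      the Hessian takes the value \<open>H p p\<close> on it. The second-order condition bounds this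
      by \<open>4 * lam\<close>, whereas \<open>H_diag\<close> with \<open>mu > 0\<close> makes it
      larger.\<close>
    have distinct: "p = q" if "a $ p = a $ q" "a $ p < 0" for p q
    proof (rule ccontr)
      assume "p \<noteq> q"
      have m: "m p = m q" using that by (simp add: m_def)
      have "2 * mu / a $ p < 0" using that assms(4) by (simp add: divide_pos_neg)
      then have pos: "(m p + 1) * (H p p / 2 - 2 * lam) > 0"
        using H_diag[of p] that lam by linarith
      then have gt: "H p p > 4 * lam" by (simp add: zero_less_mult_iff m_def)
      have "(m p + 1) * (H p p / 2 - 2 * lam) = (m p + 1) * (H q q / 2 - 2 * lam)"
        using H_diag[of p] H_diag[of q] that m by simp
      then have "H p p = H q q" by (simp add: m_def)
      then have "f'' a (?e p - ?e q) (?e p - ?e q) = H p p"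
        using H_eq[of p q] H_eq[of q p] that \<open>p \<noteq> q\<close>
        by (simp add: blinfun.diff_left blinfun.diff_right H_def)
      moreover have "(?e p - ?e q) \<bullet> (?e p - ?e q) = 2"
        using \<open>p \<noteq> q\<close> by (simp add: inner_diff_left inner_diff_right inner_axis_axis)
      moreover have "f'' a (?e p - ?e q) (?e p - ?e q) \<le> 2 * lam * ((?e p - ?e q) \<bullet> (?e p - ?e q))"
        using that by (intro second) (simp_all add: sum_subtractf sum_axis inner_diff_right inner_axis)
      ultimately show False using gt by simp
    qed
    have H_neg: "H p p = - 2 * lam - 2 * mu / a $ p" if "a $ p < 0" for p
    proof -
      have "{i. a $ i = a $ p} = {p}" using distinct[of p] that by (metis (mono_tags, lifting) Collect_cong singleton_conv)
      then have "m p = 1" by (simp add: m_def)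
      then show ?thesis using H_diag[of p] that by simp
    qed
    \<comment> \<open>Symmetry is needed only in the row of a negative coordinate, where
      \<open>distinct\<close> makes every off-diagonal entry equal to
      \<open>2 * lam\<close>.\<close>
    have H_sym: "H i p = H p i" if "a $ p < 0" for p i
    proof (cases "i = p")
      case False
      then have "a $ p \<noteq> a $ i" using distinct[of p i] that by blast
      then show ?thesis using H_ne[of p i] H_ne[of i p] by simp
    qed simp
    have col: "f'' a a (?e p) = - 2 * f' a (?e p)" if "a $ p < 0" for p
    proof -
      have "f'' a a (?e p) = (\<Sum>i\<in>UNIV. a $ i * H i p)"
        by (simp add: blinfun_apply_eq_sum_axis[of "f'' a" a] H_def blinfun.sum_left blinfun.scaleR_left)
      also have "\<dots> = f'' a (?e p) a"
        using that H_sym[of p] by (simp add: blinfun_apply_eq_sum_axis[of "f'' a (?e p)" a] H_def)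
      finally show ?thesis by (simp add: row)
    qed
    \<comment> \<open>Since \<open>a \<bullet> (?e j - ?e k) = - w\<close>, adding
      \<open>w *\<^sub>R a\<close> restores orthogonality to \<open>a\<close>.\<close>
    define w where "w = a $ k - a $ j"
    \<comment> \<open>the tangent vector in the span of \<open>a, e\<^sub>j, e\<^sub>k\<close>, unique up to scaling\<close>
    define v where "v = w *\<^sub>R a + (?e j - ?e k)"
    have ne: "a $ j \<noteq> a $ k" using distinct neg jk by blast
    have vv: "v \<bullet> v = 2 - w\<^sup>2"
    proof -
      have "(?e j - ?e k) \<bullet> (?e j - ?e k) = 2"
        using jk by (simp add: inner_diff_left inner_diff_right inner_axis_axis)
      moreover have "a \<bullet> (?e j - ?e k) = - w" by (simp add: inner_diff_right inner_axis w_def)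
      moreover from this have "(?e j - ?e k) \<bullet> a = - w" by (subst inner_commute)
      ultimately show ?thesis
        unfolding v_def inner_add_left inner_add_right inner_scaleR_left inner_scaleR_right
        by (simp add: aa power2_eq_square)
    qed
    have "(\<Sum>i\<in>UNIV. v $ i) = 0"
      using sum0 by (simp add: v_def sum.distrib sum_subtractf sum_axis flip: sum_distrib_left)
    moreover have "a \<bullet> v = 0"
      using aa by (simp add: v_def inner_add_right inner_diff_right inner_axis w_def)
    ultimately have "f'' a v v \<le> 2 * lam * (2 - w\<^sup>2)"
      using second vv by metis
    moreover have "f'' a v v = w * (w * f'' a a a) + w * (f'' a a (?e j) - f'' a a (?e k))
        + w * (f'' a (?e j) a - f'' a (?e k) a) + (H j j - H j k - H k j + H k k)"
      by (simp add: v_def H_def blinfun.add_left blinfun.add_right blinfun.diff_left blinfun.diff_right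
          blinfun.scaleR_left blinfun.scaleR_right algebra_simps)
    \<comment> \<open>The \<open>a\<close>-\<open>a\<close> term contributes
      \<open>-4 * lam * w^2\<close> and each of the two mixed terms \<open>4 * lam * w^2\<close>;
      the rest comes from the block of \<open>H\<close> on j and k.\<close>
    moreover have "\<dots> = 4 * lam * w\<^sup>2 - 8 * lam - 2 * mu / a $ j - 2 * mu / a $ k"
      using neg H_ne[of j k] H_ne[of k j] ne
      by (simp add: row col grad grad_a H_neg w_def power2_eq_square algebra_simps)
    ultimately have "6 * lam * w\<^sup>2 - 12 * lam - 2 * mu / a $ j - 2 * mu / a $ k \<le> 0"
      by (simp add: algebra_simps)
    \<comment> \<open>This expression is \<open>-6 * lam * (v \<bullet> v)\<close>, nonnegative
      because \<open>lam \<le> 0\<close>.\<close>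
    moreover have "6 * lam * w\<^sup>2 - 12 * lam \<ge> 0"
      using lam mult_nonpos_nonneg[of "6 * lam" "2 - w\<^sup>2"] inner_ge_zero[of v]
      unfolding vv by (simp add: right_diff_distrib)
    moreover have "2 * mu / a $ j < 0" "2 * mu / a $ k < 0"
      using neg assms(4) by (simp_all add: divide_pos_neg)
    ultimately show False by linarith
  qed
  then have "{j. a $ j < 0} = {j0}" using j0 by blast
  then show ?thesis by simp
qed

end
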